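(* Let $X$ be a space (a strongly discrete metric space with bounded geometry), $E$ a Banach space and $\omega$ a non-principal ultrafilter on $X$. Suppose $A\in\mathcal A^\infty_E(X)$ is rich at $\omega$, and let $\Phi_\omega(A)=[\Phi_\omega(A)_{\alpha\beta}]_{\alpha,\beta\in X(\omega)}$ be the associated $X(\omega)$-by-$X(\omega)$ matrix. Then there exists a unique operator in $\mathcal S^\infty_E(X(\omega))$ with matrix coefficients $\{\Phi_\omega(A)_{\alpha\beta}\}_{\alpha,\beta\in X(\omega)}$ and norm at most $\|A\|$. Furthermore, this operator belongs to $\mathcal A^\infty_E(X(\omega))$.
   Context: A metric space $X$ has bounded geometry if $\sup_{x\in X}\sharp B(x,R)<\infty$ for every $R$; it is strongly discrete if $\{d(x,y):x,y\in X\}$ is a discrete subset of $\mathbb R$. A "space" is a strongly discrete metric space with bounded geometry. For a space $Y$: $\ell^\infty_E(Y)$ is the Banach space of bounded functions $Y\to E$; for finite $F\subseteq Y$, $P_F$ is multiplication by the characteristic function of $F$ and $Q_F=I-P_F$; $\mathcal S^\infty_E(Y)$ is the set of bounded linear operators $T$ on $\ell^\infty_E(Y)$ such that for every finite $F'\subseteq Y$, $\lim_F\|P_{F'}TQ_F\|=0$ along the net of finite subsets $F$ of $Y$ ordered by inclusion. The matrix coefficients of $T$ are $T_{xy}\in\mathfrak B(E)$, $T_{xy}e=(T(e\delta_y))(x)$, where $e\delta_y$ takes value $e$ at $y$ and $0$ elsewhere. A band operator on $Y$ is a $Y$-by-$Y$ matrix with uniformly norm-bounded entries in $\mathfrak B(E)$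 and finite propagation $\sup\{d(x,y):A_{xy}\neq0\}$, acting by matrix multiplication; $\mathcal A^\infty_E(Y)$ is the norm closure of the band operators in $\mathfrak B(\ell^\infty_E(Y))$. Ultrafilters are viewed as $\{0,1\}$-valued finitely additive measures. A partial translation is a bijection $t:D\to R$ between subsets of $X$ with $\sup_{x\in D}d(x,t(x))<\infty$. It is compatible with $\omega$ if $\omega(D)=1$; then $t(\omega)=\lim_\omega t$ is the ultrafilter with $t(\omega)(S)=1$ iff $\omega(t^{-1}(S\cap R))=1$. $X(\omega)$ is the set of ultrafilters of the form $t(\omega)$ with $t$ compatible with $\omega$. A compatible family for $\omega$ is a choice for each $\alpha\in X(\omega)$ of $t_\alpha$ compatible with $\omega$ with $t_\alpha(\omega)=\alpha$. $X(\omega)$ has the metric $d_\omega(\alpha,\beta)=\lim_{x\to\omega}d(t_\alpha(x),t_\beta(x))$ (independent of the family) and is again a space. $A\in\mathcal A^\infty_E(X)$ is rich at $\omega$ if for all partial translations $t,s$ compatible with $\omega$, $\lim_{x\to\omega}A_{t(x)s(x)}$ exists in norm in $\mathfrak B(E)$. Then $\Phi_\omega(A)_{\alpha\beta}:=\lim_{x\to\omega}A_{t_\alpha(x)t_\beta(x)}$ (independent of the compatible family). *)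

theory Defs
  imports "HOL-Analysis.Analysis" "HOL-Probability.Discrete_Topology"
begin

section \<open>Scalars\<close>

text \<open>A Banach space over an arbitrary scalar field, i.e. over the reals or the complex numbers.
  The library class \<open>banach\<close> only knows the underlying real scalar multiplication; the locale adds
  a scalar multiplication by \<open>'k\<close> that restricts to it. For \<open>'k = real\<close> it is \<open>scaleR\<close>.
  An element of the library type \<open>_ \<Rightarrow>\<^sub>L _\<close> is bounded and real-linear, so linearity over \<open>'k\<close>
  is imposed separately below.\<close>

locale banach_over = vector_space smul
  for smul :: "'k::real_normed_field \<Rightarrow> 'e::banach \<Rightarrow> 'e" +
  assumes smul_of_real: "smul (of_real r) e = r *\<^sub>R e"
    and norm_smul: "norm (smul c e) = norm c * norm e"

definition scalar_linear :: "('k \<Rightarrow> 'e \<Rightarrow> 'e) \<Rightarrow> ('e::real_normed_vector \<Rightarrow>\<^sub>L 'e) \<Rightarrow> bool" where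
  "scalar_linear smul B \<longleftrightarrow>
     (\<forall>c e. blinfun_apply B (smul c e) = smul c (blinfun_apply B e))"


section \<open>Bounded functions and their operators\<close>

text \<open>All functions on a discrete space are continuous, so this is the space of all bounded
  functions on the type \<open>'y\<close> with the supremum norm.\<close>

type_synonym ('y, 'e) linf = "'y discrete \<Rightarrow>\<^sub>C 'e"

definition ev :: "('y, 'e::real_normed_vector) linf \<Rightarrow> 'y \<Rightarrow> 'e" where
  "ev f y = apply_bcontfun f (discrete y)"

lemma bcontfun_discrete_iff:
  "(f :: 'y discrete \<Rightarrow> 'e::real_normed_vector) \<in> bcontfun \<longleftrightarrow> bounded (range f)"
proof -
  have "continuous_on UNIV f"
    by (simp add: continuous_on_open_vimage open_discrete)
  then show ?thesis by (simp add: bcontfun_def)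
qed

lemma linf_eqI: "(\<And>y. ev f y = ev g y) \<Longrightarrow> f = g"
  by (rule bcontfun_eqI) (metis ev_def of_discrete_inverse)

definition restr :: "'y set \<Rightarrow> ('y, 'e::real_normed_vector) linf \<Rightarrow> ('y, 'e) linf" where
  "restr S f = Bcontfun (\<lambda>y. if of_discrete y \<in> S then apply_bcontfun f y else 0)"

lemma restr_rep_eq:
  "apply_bcontfun (restr S f) = (\<lambda>y. if of_discrete y \<in> S then apply_bcontfun f y else 0)"
proof -
  have "bounded (insert 0 (range (apply_bcontfun f)))"
    by simp
  then have "bounded (range (\<lambda>y. if of_discrete y \<in> S then apply_bcontfun f y else 0))"
    by (rule bounded_subset) auto
  then show ?thesis
    by (simp add: restr_def bcontfun_discrete_iff Bcontfun_inverse)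
qed

lemma ev_restr: "ev (restr S f) y = (if y \<in> S then ev f y else 0)"
  by (simp add: ev_def restr_rep_eq discrete_inverse)

text \<open>Multiplication by the characteristic function of \<open>S\<close>.\<close>

definition proj :: "'y set \<Rightarrow> ('y, 'e::real_normed_vector) linf \<Rightarrow>\<^sub>L ('y, 'e) linf" where
  "proj S = Blinfun (restr S)"

lemma bounded_linear_restr:
  "bounded_linear (restr S :: ('y, 'e::real_normed_vector) linf \<Rightarrow> ('y, 'e) linf)"
proof (rule bounded_linear_intro[where K = 1])
  fix f g :: "('y, 'e) linf" and r :: real
  show "restr S (f + g) = restr S f + restr S g"
    by (rule bcontfun_eqI) (simp add: restr_rep_eq plus_bcontfun.rep_eq)
  show "restr S (r *\<^sub>R f) = r *\<^sub>R restr S f"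
    by (rule bcontfun_eqI) (simp add: restr_rep_eq scaleR_bcontfun.rep_eq)
  show "norm (restr S f) \<le> norm f * 1"
    by (rule norm_bound) (use norm_bounded[of f] in
        \<open>auto simp: restr_rep_eq intro: order_trans[OF norm_ge_zero]\<close>)
qed

lemma ev_proj: "ev (blinfun_apply (proj S) f) y = (if y \<in> S then ev f y else 0)"
  by (simp add: proj_def bounded_linear_Blinfun_apply[OF bounded_linear_restr] ev_restr)

text \<open>For \<open>Y :: 'y set\<close>, the space of bounded functions on \<open>Y\<close> is identified (isometrically, by
  extension by zero) with the range of \<open>proj Y\<close>, and its algebra of bounded operators
  (isometrically, by \<open>T \<mapsto> proj Y T proj Y\<close>) with the corner of all \<open>T\<close> satisfying
  \<open>T = proj Y T proj Y\<close>. For \<open>Y = UNIV\<close> the corner condition is vacuous.\<close>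

definition operators_on ::
  "('k \<Rightarrow> 'e \<Rightarrow> 'e) \<Rightarrow> 'y set \<Rightarrow> (('y, 'e::real_normed_vector) linf \<Rightarrow>\<^sub>L ('y, 'e) linf) set" where
  "operators_on smul Y = {T. T = proj Y o\<^sub>L T o\<^sub>L proj Y \<and>
     (\<forall>c f g. (\<forall>y. ev g y = smul c (ev f y)) \<longrightarrow>
        (\<forall>y. ev (blinfun_apply T g) y = smul c (ev (blinfun_apply T f) y)))}"

definition delta :: "'y \<Rightarrow> 'e::real_normed_vector \<Rightarrow> ('y, 'e) linf" where
  "delta y e = Bcontfun (\<lambda>z. if of_discrete z = y then e else 0)"

lemma delta_rep_eq:
  "apply_bcontfun (delta y e) = (\<lambda>z. if of_discrete z = y then e else 0)"
proof -
  have "bounded (range (\<lambda>z. if of_discrete z = y then e else 0))"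
    by (rule bounded_subset[of "{e, 0}"]) auto
  then show ?thesis
    by (simp add: delta_def bcontfun_discrete_iff Bcontfun_inverse)
qed

lemma ev_delta: "ev (delta y e) z = (if z = y then e else 0)"
  by (simp add: ev_def delta_rep_eq discrete_inverse)

lemma bounded_linear_delta:
  "bounded_linear (delta y :: 'e::real_normed_vector \<Rightarrow> ('y, 'e) linf)"
proof (rule bounded_linear_intro[where K = 1])
  fix e e' :: 'e and r :: real
  show "delta y (e + e') = delta y e + delta y e'"
    by (rule bcontfun_eqI) (simp add: delta_rep_eq plus_bcontfun.rep_eq)
  show "delta y (r *\<^sub>R e) = r *\<^sub>R delta y e"
    by (rule bcontfun_eqI) (simp add: delta_rep_eq scaleR_bcontfun.rep_eq)
  show "norm (delta y e) \<le> norm e * 1"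
    by (rule norm_bound) (auto simp: delta_rep_eq)
qed

lemma bounded_linear_ev:
  "bounded_linear (\<lambda>f :: ('y, 'e::real_normed_vector) linf. ev f x)"
  by (rule bounded_linear_intro[where K = 1])
    (auto simp: ev_def plus_bcontfun.rep_eq scaleR_bcontfun.rep_eq intro: norm_bounded)

definition mat_coeff ::
  "(('y, 'e::real_normed_vector) linf \<Rightarrow>\<^sub>L ('y, 'e) linf) \<Rightarrow> 'y \<Rightarrow> 'y \<Rightarrow> ('e \<Rightarrow>\<^sub>L 'e)" where
  "mat_coeff T x y = Blinfun (\<lambda>e. ev (blinfun_apply T (delta y e)) x)"

lemma mat_coeff_apply: "blinfun_apply (mat_coeff T x y) e = ev (blinfun_apply T (delta y e)) x"
  unfolding mat_coeff_def
  by (subst bounded_linear_Blinfun_apply)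
    (auto intro!: bounded_linear_compose[OF bounded_linear_ev]
      bounded_linear_compose[OF blinfun.bounded_linear_right bounded_linear_delta])

definition S_inf ::
  "('k \<Rightarrow> 'e \<Rightarrow> 'e) \<Rightarrow> 'y set \<Rightarrow> (('y, 'e::real_normed_vector) linf \<Rightarrow>\<^sub>L ('y, 'e) linf) set" where
  "S_inf smul Y = {T \<in> operators_on smul Y.
     \<forall>F'. finite F' \<and> F' \<subseteq> Y \<longrightarrow>
       ((\<lambda>F. norm (proj F' o\<^sub>L T o\<^sub>L (proj Y - proj F))) \<longlongrightarrow> 0) (finite_subsets_at_top Y)}"


section \<open>Band operators\<close>

definition band_matrix ::
  "('k \<Rightarrow> 'e \<Rightarrow> 'e) \<Rightarrow> 'y set \<Rightarrow> ('y \<Rightarrow> 'y \<Rightarrow> real) \<Rightarrow>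
     ('y \<Rightarrow> 'y \<Rightarrow> ('e::real_normed_vector \<Rightarrow>\<^sub>L 'e)) \<Rightarrow> bool" where
  "band_matrix smul Y d a \<longleftrightarrow>
     (\<forall>x\<in>Y. \<forall>y\<in>Y. scalar_linear smul (a x y)) \<and>
     (\<exists>C. \<forall>x\<in>Y. \<forall>y\<in>Y. norm (a x y) \<le> C) \<and>
     bdd_above {d x y | x y. x \<in> Y \<and> y \<in> Y \<and> a x y \<noteq> 0}"

text \<open>The sums are finite when the balls of \<open>(Y, d)\<close> are, in particular for bounded geometry.\<close>

definition band_operators ::
  "('k \<Rightarrow> 'e \<Rightarrow> 'e) \<Rightarrow> 'y set \<Rightarrow> ('y \<Rightarrow> 'y \<Rightarrow> real) \<Rightarrow>
     (('y, 'e::real_normed_vector) linf \<Rightarrow>\<^sub>L ('y, 'e) linf) set" where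
  "band_operators smul Y d = {T \<in> operators_on smul Y.
     \<exists>a. band_matrix smul Y d a \<and>
       (\<forall>f. \<forall>x\<in>Y. ev (blinfun_apply T f) x =
          (\<Sum>y\<in>{y \<in> Y. a x y \<noteq> 0}. blinfun_apply (a x y) (ev f y)))}"

definition A_inf ::
  "('k \<Rightarrow> 'e \<Rightarrow> 'e) \<Rightarrow> 'y set \<Rightarrow> ('y \<Rightarrow> 'y \<Rightarrow> real) \<Rightarrow>
     (('y, 'e::real_normed_vector) linf \<Rightarrow>\<^sub>L ('y, 'e) linf) set" where
  "A_inf smul Y d = closure (band_operators smul Y d)"


section \<open>Spaces and ultrafilters\<close>

text \<open>The metric space is a whole type; \<open>Isolated.discrete\<close> is the library predicate on sets
  (the unqualified name is the constructor of the type \<open>discrete\<close>).\<close>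

definition bounded_geometry :: "'x::metric_space itself \<Rightarrow> bool" where
  "bounded_geometry _ \<longleftrightarrow> (\<forall>R. \<exists>N. \<forall>x::'x. finite (cball x R) \<and> card (cball x R) \<le> N)"

definition strongly_discrete :: "'x::metric_space itself \<Rightarrow> bool" where
  "strongly_discrete _ \<longleftrightarrow> Isolated.discrete {dist x y | x y :: 'x. True}"

text \<open>\<open>\<omega>(S) = 1\<close> is rendered as \<open>\<forall>\<^sub>F x in \<omega>. x \<in> S\<close>. The principal ultrafilter at \<open>x\<close> is
  \<open>principal {x}\<close>.\<close>

definition ultrafilter :: "'x filter \<Rightarrow> bool" where
  "ultrafilter \<omega> \<longleftrightarrow> \<omega> \<noteq> bot \<and>
     (\<forall>S. (\<forall>\<^sub>F x in \<omega>. x \<in> S) \<or> (\<forall>\<^sub>F x in \<omega>. x \<notin> S))"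

definition nonprincipal_ultrafilter :: "'x filter \<Rightarrow> bool" where
  "nonprincipal_ultrafilter \<omega> \<longleftrightarrow> ultrafilter \<omega> \<and> (\<forall>x. \<omega> \<noteq> principal {x})"

text \<open>A partial translation is a partial function \<open>t\<close> with \<open>D = dom t\<close> and \<open>R = ran t\<close>.
  The values of \<open>app t\<close> outside \<open>dom t\<close> are irrelevant.\<close>

definition app :: "('x \<rightharpoonup> 'x) \<Rightarrow> 'x \<Rightarrow> 'x" where
  "app t x = the (t x)"

definition partial_translation :: "('x::metric_space \<rightharpoonup> 'x) \<Rightarrow> bool" where
  "partial_translation t \<longleftrightarrow>
     bij_betw (app t) (dom t) (ran t) \<and> bdd_above ((\<lambda>x. dist x (app t x)) ` dom t)"

definition compatible :: "'x::metric_space filter \<Rightarrow> ('x \<rightharpoonup> 'x) \<Rightarrow> bool" where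
  "compatible \<omega> t \<longleftrightarrow> partial_translation t \<and> (\<forall>\<^sub>F x in \<omega>. x \<in> dom t)"

definition translate :: "('x \<rightharpoonup> 'x) \<Rightarrow> 'x filter \<Rightarrow> 'x filter" where
  "translate t \<omega> = filtermap (app t) \<omega>"

lemma eventually_translate_iff:
  assumes "compatible \<omega> t"
  shows "(\<forall>\<^sub>F y in translate t \<omega>. y \<in> S) \<longleftrightarrow>
    (\<forall>\<^sub>F x in \<omega>. x \<in> {x \<in> dom t. app t x \<in> S \<inter> ran t})"
proof -
  have dom: "\<forall>\<^sub>F x in \<omega>. x \<in> dom t"
    using assms by (simp add: compatible_def)
  have "app t x \<in> ran t" if "x \<in> dom t" for x
    using that by (auto simp: app_def ran_def)
  then have "\<forall>\<^sub>F x in \<omega>. app t x \<in> S \<longleftrightarrow> x \<in> {x \<in> dom t. app t x \<in> S \<inter> ran t}"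
    using dom by (auto elim!: eventually_mono)
  then show ?thesis
    unfolding translate_def eventually_filtermap by (rule eventually_subst)
qed

text \<open>The set \<open>X(\<omega>)\<close>.\<close>

definition limit_space :: "'x::metric_space filter \<Rightarrow> 'x filter set" where
  "limit_space \<omega> = {translate t \<omega> | t. compatible \<omega> t}"

definition compatible_family ::
  "'x::metric_space filter \<Rightarrow> ('x filter \<Rightarrow> 'x \<rightharpoonup> 'x) \<Rightarrow> bool" where
  "compatible_family \<omega> t \<longleftrightarrow>
     (\<forall>\<alpha>\<in>limit_space \<omega>. compatible \<omega> (t \<alpha>) \<and> translate (t \<alpha>) \<omega> = \<alpha>)"

text \<open>The metric and the matrix below do not depend on the compatible family \<open>t\<close>; it is
  kept as an explicit parameter.\<close>

definition limit_dist ::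
  "'x::metric_space filter \<Rightarrow> ('x filter \<Rightarrow> 'x \<rightharpoonup> 'x) \<Rightarrow> 'x filter \<Rightarrow> 'x filter \<Rightarrow> real" where
  "limit_dist \<omega> t \<alpha> \<beta> = Lim \<omega> (\<lambda>x. dist (app (t \<alpha>) x) (app (t \<beta>) x))"

definition rich_at ::
  "'x::metric_space filter \<Rightarrow> (('x, 'e::real_normed_vector) linf \<Rightarrow>\<^sub>L ('x, 'e) linf) \<Rightarrow> bool" where
  "rich_at \<omega> A \<longleftrightarrow>
     (\<forall>t s. compatible \<omega> t \<and> compatible \<omega> s \<longrightarrow>
        (\<exists>L. ((\<lambda>x. mat_coeff A (app t x) (app s x)) \<longlongrightarrow> L) \<omega>))"

definition limit_matrix ::
  "'x::metric_space filter \<Rightarrow> ('x filter \<Rightarrow> 'x \<rightharpoonup> 'x) \<Rightarrow>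
     (('x, 'e::real_normed_vector) linf \<Rightarrow>\<^sub>L ('x, 'e) linf) \<Rightarrow>
     'x filter \<Rightarrow> 'x filter \<Rightarrow> ('e \<Rightarrow>\<^sub>L 'e)" where
  "limit_matrix \<omega> t A \<alpha> \<beta> = Lim \<omega> (\<lambda>x. mat_coeff A (app (t \<alpha>) x) (app (t \<beta>) x))"

end

theory Submission
  imports Defs
begin

text \<open>An operator on a space of bounded functions is controlled row by row. Hence cutting the matrix
  of \<open>A\<close> down to propagation \<open>R\<close> changes the norm by at most \<open>\<parallel>A - B\<parallel>\<close> for every band
  operator \<open>B\<close> of propagation at most \<open>R\<close>: a row outside its \<open>R\<close>-neighbourhood is a piece of a
  row of \<open>A - B\<close>. Both this tail estimate and the row bound by \<open>\<parallel>A\<parallel>\<close> involve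
  finitely many entries at a time, so they pass to the limit along \<open>\<omega>\<close>. The cut-downs of the limit
  matrix therefore form a Cauchy sequence of band operators, and its limit is the operator sought.
  Operators in \<open>S_inf\<close> are determined by their matrix coefficients, which gives uniqueness.\<close>

section \<open>Bounded functions, operators and matrix coefficients\<close>

lemma ev_bound: "norm (ev f y) \<le> norm f"
  unfolding ev_def by (rule norm_bounded)

lemma norm_linf_le:
  assumes "\<And>y. norm (ev f y) \<le> c"
  shows "norm f \<le> c"
proof (rule norm_bound)
  fix z
  show "norm (apply_bcontfun f z) \<le> c"
    using assms[of "of_discrete z"] by (simp add: ev_def of_discrete_inverse)
qed

lemmas ev_add = linear_add[OF bounded_linear.linear[OF bounded_linear_ev]]
  and ev_diff = linear_diff[OF bounded_linear.linear[OF bounded_linear_ev]]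
  and ev_scaleR = linear_cmul[OF bounded_linear.linear[OF bounded_linear_ev]]
  and ev_sum = linear_sum[OF bounded_linear.linear[OF bounded_linear_ev]]

lemma ev_Bcontfun:
  assumes "bounded (range h)"
  shows "ev (Bcontfun (h \<circ> of_discrete)) y = h y"
proof -
  have "h \<circ> of_discrete \<in> bcontfun"
    unfolding bcontfun_discrete_iff by (rule bounded_subset[OF assms]) auto
  then show ?thesis
    unfolding ev_def by (simp add: Bcontfun_inverse discrete_inverse)
qed

lemma norm_op_le:
  fixes T :: "('y, 'e::real_normed_vector) linf \<Rightarrow>\<^sub>L ('z, 'e) linf"
  assumes "0 \<le> K" "\<And>f x. norm (ev (blinfun_apply T f) x) \<le> K * norm f"
  shows "norm T \<le> K"
  using assms by (intro norm_blinfun_bound norm_linf_le)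

lemma op_eqI:
  fixes T :: "('y, 'e::real_normed_vector) linf \<Rightarrow>\<^sub>L ('z, 'e) linf"
  assumes "\<And>f x. ev (blinfun_apply T f) x = ev (blinfun_apply T' f) x"
  shows "T = T'"
  by (intro blinfun_eqI linf_eqI assms)

lemma ev_op_bound:
  "norm (ev (blinfun_apply T f) x) \<le> norm T * norm f"
  using ev_bound norm_blinfun by (rule order_trans)

lemma bounded_linear_op_ev: "bounded_linear (\<lambda>T. ev (blinfun_apply T f) x)"
  by (rule bounded_linear_compose[OF bounded_linear_ev blinfun.bounded_linear_left])

lemmas tendsto_op_ev = bounded_linear.tendsto[OF bounded_linear_op_ev]

lemma mat_coeff_diff: "mat_coeff (S - T) x y = mat_coeff S x y - mat_coeff T x y"
  by (rule blinfun_eqI) (simp add: mat_coeff_apply blinfun.diff_left ev_diff)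

lemma ev_op_sum_delta:
  "ev (blinfun_apply T (\<Sum>y\<in>F. delta y (g y))) x = (\<Sum>y\<in>F. blinfun_apply (mat_coeff T x y) (g y))"
  by (simp add: blinfun.sum_right ev_sum mat_coeff_apply)

lemma ev_sum_delta:
  "finite F \<Longrightarrow> ev (\<Sum>y\<in>F. delta y (g y)) z = (if z \<in> F then g z else 0)"
  by (simp add: ev_sum ev_delta sum.delta)

lemma proj_finite_eq_sum_delta:
  "finite F \<Longrightarrow> blinfun_apply (proj F) f = (\<Sum>y\<in>F. delta y (ev f y))"
  by (rule linf_eqI) (simp add: ev_proj ev_sum_delta)

lemma ev_op_support:
  assumes "T = proj Y o\<^sub>L T o\<^sub>L proj Y"
  shows "ev (blinfun_apply T f) x = (if x \<in> Y then ev (blinfun_apply T (blinfun_apply (proj Y) f)) x else 0)"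
  by (subst assms) (simp add: ev_proj)

text \<open>Completeness of the bounded functions makes the space of operators between them
  complete, so that a Cauchy sequence of band operators has a limit.\<close>

instance bcontfun :: (metric_space, banach) banach ..

section \<open>Scalars\<close>

context banach_over
begin

lemma bounded_linear_smul: "bounded_linear (smul c)"
proof (rule bounded_linear_intro[where K = "norm c"])
  fix x y :: 'e and r :: real
  show "smul c (x + y) = smul c x + smul c y"
    by (rule scale_right_distrib)
  show "smul c (r *\<^sub>R x) = r *\<^sub>R smul c x"
    \<comment> \<open>Real scaling is \<open>smul\<close> by an element of the commutative field
      \<open>'k\<close>, so it commutes with \<open>smul c\<close>.\<close>
    unfolding smul_of_real[symmetric] by (simp add: mult.commute)
  show "norm (smul c x) \<le> norm x * norm c"
    by (simp add: norm_smul)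
qed

lemma scalar_linear_limit:
  assumes "F \<noteq> bot" "(B \<longlongrightarrow> L) F" "\<forall>\<^sub>F i in F. scalar_linear smul (B i)"
  shows "scalar_linear smul L"
  unfolding scalar_linear_def
proof (intro allI)
  fix c e
  have "((\<lambda>i. B i (smul c e)) \<longlongrightarrow> L (smul c e)) F"
    using assms(2) by (intro tendsto_intros)
  moreover have "((\<lambda>i. B i (smul c e)) \<longlongrightarrow> smul c (L e)) F"
  proof (rule Lim_transform_eventually)
    show "((\<lambda>i. smul c (B i e)) \<longlongrightarrow> smul c (L e)) F"
      using assms(2) by (intro bounded_linear.tendsto[OF bounded_linear_smul] tendsto_intros)
    show "\<forall>\<^sub>F i in F. smul c (B i e) = B i (smul c e)"
      using assms(3) by eventually_elim (simp add: scalar_linear_def)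
  qed
  ultimately show "L (smul c e) = smul c (L e)"
    using assms(1) by (metis tendsto_unique)
qed

text \<open>Compression to \<open>proj Y\<close> and evaluation at a point are continuous in the
  operator, and \<open>smul c\<close> is continuous on \<open>'e\<close>; both defining identities
  therefore survive norm limits.\<close>

lemma operators_on_limit:
  fixes B :: "'i \<Rightarrow> (('y, 'e) linf \<Rightarrow>\<^sub>L ('y, 'e) linf)"
  assumes "F \<noteq> bot" "(B \<longlongrightarrow> T) F" "\<And>i. B i \<in> operators_on smul Y"
  shows "T \<in> operators_on smul Y"
  unfolding operators_on_def
proof (intro CollectI conjI allI impI)
  have "((\<lambda>i. proj Y o\<^sub>L B i o\<^sub>L proj Y) \<longlongrightarrow> proj Y o\<^sub>L T o\<^sub>L proj Y) F"
    using assms(2) by (intro tendsto_intros)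
  moreover have "(\<lambda>i. proj Y o\<^sub>L B i o\<^sub>L proj Y) = B"
    using assms(3) by (auto simp: operators_on_def)
  ultimately show "T = proj Y o\<^sub>L T o\<^sub>L proj Y"
    using assms(1,2) by (metis tendsto_unique)
next
  fix c y and f g :: "('y, 'e) linf"
  assume fg: "\<forall>y. ev g y = smul c (ev f y)"
  have "((\<lambda>i. ev (B i g) y) \<longlongrightarrow> ev (T g) y) F"
    by (rule tendsto_op_ev[OF assms(2)])
  moreover have "((\<lambda>i. smul c (ev (B i f) y)) \<longlongrightarrow> smul c (ev (T f) y)) F"
    by (rule bounded_linear.tendsto[OF bounded_linear_smul tendsto_op_ev[OF assms(2)]])
  moreover have "ev (B i g) y = smul c (ev (B i f) y)" for i
    using assms(3)[of i] fg unfolding operators_on_def by blast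
  ultimately show "ev (T g) y = smul c (ev (T f) y)"
    using assms(1) tendsto_unique by auto
qed

lemma scalar_linear_mat_coeff:
  assumes "T \<in> operators_on smul Y"
  shows "scalar_linear smul (mat_coeff T x y)"
  unfolding scalar_linear_def mat_coeff_apply
proof (intro allI)
  fix c e
  have "\<forall>z. ev (delta y (smul c e)) z = smul c (ev (delta y e) z)"
    by (simp add: ev_delta)
  then show "ev (T (delta y (smul c e))) x = smul c (ev (T (delta y e)) x)"
    using assms unfolding operators_on_def by blast
qed

lemma A_inf_subset_operators_on: "A_inf smul Y d \<subseteq> operators_on smul Y"
proof
  have band_subset: "band_operators smul Y d \<subseteq> operators_on smul Y"
    unfolding band_operators_def by (rule Collect_restrict)
  fix T assume "T \<in> A_inf smul Y d"
  then obtain B where "\<And>n::nat. B n \<in> band_operators smul Y d" "B \<longlonglongrightarrow> T"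
    unfolding A_inf_def closure_sequential by auto
  then show "T \<in> operators_on smul Y"
    using band_subset by (intro operators_on_limit[of sequentially B T Y]) auto
qed

end

section \<open>Rows\<close>

text \<open>The norm of a row as an operator on finitely supported bounded functions on \<open>S\<close> is at most \<open>K\<close>.\<close>

definition row_bound :: "('y \<Rightarrow> ('e::real_normed_vector \<Rightarrow>\<^sub>L 'e)) \<Rightarrow> 'y set \<Rightarrow> real \<Rightarrow> bool" where
  "row_bound r S K \<longleftrightarrow> (\<forall>F g c. finite F \<and> F \<subseteq> S \<and> 0 \<le> c \<and> (\<forall>y\<in>F. norm (g y) \<le> c) \<longrightarrow>
     norm (\<Sum>y\<in>F. blinfun_apply (r y) (g y)) \<le> K * c)"

lemma row_boundI:
  assumes "\<And>F g c. finite F \<Longrightarrow> F \<subseteq> S \<Longrightarrow> 0 \<le> c \<Longrightarrow> (\<And>y. y \<in> F \<Longrightarrow> norm (g y) \<le> c) \<Longrightarrow>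
     norm (\<Sum>y\<in>F. blinfun_apply (r y) (g y)) \<le> K * c"
  shows "row_bound r S K"
  unfolding row_bound_def by (intro allI impI, elim conjE) (rule assms; simp)

lemma row_boundD:
  assumes "row_bound r S K" "finite F" "F \<subseteq> S" "0 \<le> c" "\<And>y. y \<in> F \<Longrightarrow> norm (g y) \<le> c"
  shows "norm (\<Sum>y\<in>F. blinfun_apply (r y) (g y)) \<le> K * c"
  using assms(1)[unfolded row_bound_def, rule_format, of F c g] assms(2-) by blast

lemma row_bound_entry:
  assumes "row_bound r S K" "y \<in> S" "0 \<le> K"
  shows "norm (r y) \<le> K"
proof (rule norm_blinfun_bound[OF assms(3)])
  fix e
  show "norm (r y e) \<le> K * norm e"
    using row_boundD[OF assms(1), of "{y}" "norm e" "\<lambda>_. e"] assms(2) by simp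
qed

text \<open>The sum is the value at \<open>x\<close> of \<open>T\<close> applied to the finitely
  supported function with values \<open>g\<close>, whose supremum norm is at most
  \<open>c\<close>.\<close>

lemma row_bound_mat_coeff: "row_bound (mat_coeff T x) S (norm T)"
proof (rule row_boundI)
  fix F :: "'a set" and g :: "'a \<Rightarrow> 'b" and c :: real
  assume F: "finite F" "0 \<le> c" "\<And>y. y \<in> F \<Longrightarrow> norm (g y) \<le> c"
  have "norm (\<Sum>y\<in>F. delta y (g y)) \<le> c"
    using F by (intro norm_linf_le) (simp add: ev_sum_delta)
  then have "norm T * norm (\<Sum>y\<in>F. delta y (g y)) \<le> norm T * c"
    by (simp add: mult_left_mono)
  then show "norm (\<Sum>y\<in>F. mat_coeff T x y (g y)) \<le> norm T * c"
    unfolding ev_op_sum_delta[symmetric] by (rule order_trans[OF ev_op_bound])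
qed

text \<open>Each instance of the bound tests finitely many entries. For these, distinct indices
  eventually hit distinct columns, so a test vector for \<open>m\<close> becomes one for
  \<open>r x\<close>, and the inequality passes to the limit. Here \<open>\<tau> j x\<close> is the
  column of \<open>r x\<close> that approximates column \<open>j\<close>.\<close>

lemma row_bound_limit:
  fixes \<tau> :: "'i \<Rightarrow> 'a \<Rightarrow> 'y"
  assumes "\<omega> \<noteq> bot"
    and lim: "\<And>j. j \<in> J \<Longrightarrow> ((\<lambda>x. r x (\<tau> j x)) \<longlongrightarrow> m j) \<omega>"
    and sep: "\<And>i j. i \<in> J \<Longrightarrow> j \<in> J \<Longrightarrow> i \<noteq> j \<Longrightarrow> \<forall>\<^sub>F x in \<omega>. \<tau> i x \<noteq> \<tau> j x"
    and mem: "\<And>j. j \<in> J \<Longrightarrow> \<forall>\<^sub>F x in \<omega>. \<tau> j x \<in> S x"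
    and bound: "\<And>x. row_bound (r x) (S x) K"
  shows "row_bound m J K"
proof (rule row_boundI)
  fix F and g :: "'i \<Rightarrow> 'b" and c
  assume F: "finite F" "F \<subseteq> J" and c: "0 \<le> c" "\<And>j. j \<in> F \<Longrightarrow> norm (g j) \<le> c"
  have "((\<lambda>x. norm (\<Sum>j\<in>F. r x (\<tau> j x) (g j))) \<longlongrightarrow> norm (\<Sum>j\<in>F. m j (g j))) \<omega>"
    using F lim by (intro tendsto_intros) auto
  moreover have "\<forall>\<^sub>F x in \<omega>. norm (\<Sum>j\<in>F. r x (\<tau> j x) (g j)) \<le> K * c"
  proof -
    have "\<forall>\<^sub>F x in \<omega>. \<forall>i\<in>F. \<forall>j\<in>F. i \<noteq> j \<longrightarrow> \<tau> i x \<noteq> \<tau> j x"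
      using F sep by (intro eventually_ball_finite ballI) (auto simp: eventually_conj_iff)
    moreover have "\<forall>\<^sub>F x in \<omega>. \<forall>j\<in>F. \<tau> j x \<in> S x"
      using F mem by (intro eventually_ball_finite ballI) auto
    ultimately show ?thesis
    proof eventually_elim
      fix x assume x: "\<forall>i\<in>F. \<forall>j\<in>F. i \<noteq> j \<longrightarrow> \<tau> i x \<noteq> \<tau> j x" "\<forall>j\<in>F. \<tau> j x \<in> S x"
      then have inj: "inj_on (\<lambda>j. \<tau> j x) F"
        by (auto simp: inj_on_def)
      \<comment> \<open>Transport of \<open>g\<close> to the columns \<open>\<tau> j x\<close>;
        injectivity on \<open>F\<close> makes it well defined.\<close>
      define g' where "g' = g \<circ> inv_into F (\<lambda>j. \<tau> j x)"
      have g': "g' (\<tau> j x) = g j" if "j \<in> F" for j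
        using inv_into_f_f[OF inj that] by (simp add: g'_def)
      have "norm (\<Sum>y\<in>(\<lambda>j. \<tau> j x) ` F. r x y (g' y)) \<le> K * c"
        using F c x(2) g' by (intro row_boundD[OF bound]) auto
      then show "norm (\<Sum>j\<in>F. r x (\<tau> j x) (g j)) \<le> K * c"
        by (simp add: sum.reindex[OF inj] g')
    qed
  qed
  ultimately show "norm (\<Sum>j\<in>F. m j (g j)) \<le> K * c"
    using assms(1) by (rule tendsto_upperbound)
qed

section \<open>Operators with a given matrix\<close>

text \<open>Finiteness of \<open>B x\<close> makes every row sum meaningful for all bounded
  \<open>f\<close>. The row bound with \<open>c = norm f\<close> makes the sums bounded uniformly in
  \<open>x\<close>, so they form an element of the target space.\<close>

lemma matrix_operator_exists:
  fixes a :: "'z \<Rightarrow> 'y \<Rightarrow> ('e::real_normed_vector \<Rightarrow>\<^sub>L 'e)"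
  assumes "0 \<le> K" and fin: "\<And>x. finite (B x)" and bound: "\<And>x. row_bound (a x) (B x) K"
  obtains T where "\<And>f x. ev (blinfun_apply T f) x = (\<Sum>y\<in>B x. blinfun_apply (a x y) (ev f y))"
    and "norm T \<le> K"
proof -
  define h where "h f x = (\<Sum>y\<in>B x. a x y (ev f y))" for f x
  have h_bound: "norm (h f x) \<le> K * norm f" for f x
    unfolding h_def by (rule row_boundD[OF bound fin]) (auto intro: ev_bound)
  define H where "H f = Bcontfun (h f \<circ> of_discrete)" for f
  have ev_H: "ev (H f) x = h f x" for f x
    unfolding H_def using h_bound by (intro ev_Bcontfun) (auto simp: bounded_iff)
  have "bounded_linear H"
  proof (rule bounded_linear_intro[where K = K])
    fix f g :: "('y, 'e) linf" and r :: real
    show "H (f + g) = H f + H g"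
      by (rule linf_eqI) (simp add: ev_H ev_add h_def blinfun.add_right sum.distrib)
    show "H (r *\<^sub>R f) = r *\<^sub>R H f"
      by (rule linf_eqI) (simp add: ev_H ev_scaleR h_def blinfun.scaleR_right scaleR_sum_right)
    show "norm (H f) \<le> norm f * K"
      using h_bound by (intro norm_linf_le) (simp add: ev_H mult.commute)
  qed
  then have "ev (blinfun_apply (Blinfun H) f) x = h f x" for f x
    by (simp add: bounded_linear_Blinfun_apply ev_H)
  then show thesis
    using that[of "Blinfun H"] h_bound norm_op_le[OF assms(1), of "Blinfun H"] by (simp add: h_def)
qed

text \<open>For finite \<open>F\<close>, split \<open>f\<close> on \<open>Y\<close> into its part on
  \<open>F\<close>, where both operators act through their coefficients, and the rest, whose
  contribution at a point tends to 0 along \<open>F\<close> by the defining condition of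
  \<open>S_inf\<close>.\<close>

lemma S_inf_eqI:
  fixes T T' :: "('y, 'e::real_normed_vector) linf \<Rightarrow>\<^sub>L ('y, 'e) linf"
  assumes T: "T \<in> S_inf smul Y" and T': "T' \<in> S_inf smul Y"
    and coeff: "\<And>x y. x \<in> Y \<Longrightarrow> y \<in> Y \<Longrightarrow> mat_coeff T x y = mat_coeff T' x y"
  shows "T = T'"
proof (rule op_eqI)
  fix f x
  have sup: "T = proj Y o\<^sub>L T o\<^sub>L proj Y" "T' = proj Y o\<^sub>L T' o\<^sub>L proj Y"
    using T T' unfolding S_inf_def operators_on_def by blast+
  show "ev (T f) x = ev (T' f) x"
  proof (cases "x \<in> Y")
    case False
    then show ?thesis
      using ev_op_support[OF sup(1), of f x] ev_op_support[OF sup(2), of f x] by simp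
  next
    case True
    define Q :: "'y set \<Rightarrow> ('y, 'e) linf \<Rightarrow>\<^sub>L ('y, 'e) linf" where "Q F = proj Y - proj F" for F
    let ?N = "\<lambda>T F. norm (proj {x} o\<^sub>L T o\<^sub>L Q F)"
    \<comment> \<open>The condition of \<open>S_inf\<close> is used for the single row
      \<open>F' = {x}\<close>.\<close>
    have lim: "((\<lambda>F. (?N T F + ?N T' F) * norm f) \<longlongrightarrow> (0 + 0) * norm f) (finite_subsets_at_top Y)"
      using T T' True unfolding S_inf_def Q_def by (intro tendsto_intros) auto
    have "\<forall>\<^sub>F F in finite_subsets_at_top Y. norm (ev (T f) x - ev (T' f) x) \<le> (?N T F + ?N T' F) * norm f"
      using eventually_finite_subsets_at_top_weakI
    proof (rule eventually_mono)
      show "finite F \<and> F \<subseteq> Y" if "finite F" "F \<subseteq> Y" for F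
        using that by simp
      fix F assume F: "finite F \<and> F \<subseteq> Y"
      have eq: "blinfun_apply (proj Y) f = blinfun_apply (Q F) f + blinfun_apply (proj F) f"
        by (simp add: Q_def blinfun.diff_left)
      have "ev (T (proj F f)) x = ev (T' (proj F f)) x"
        using F coeff[OF True] by (auto simp: proj_finite_eq_sum_delta ev_op_sum_delta intro!: sum.cong)
      then have "ev (T f) x - ev (T' f) x = ev (T (Q F f)) x - ev (T' (Q F f)) x"
        using True ev_op_support[OF sup(1), of f x] ev_op_support[OF sup(2), of f x]
        by (simp add: eq blinfun.add_right ev_add)
      moreover have "norm (ev (S (Q F f)) x) \<le> ?N S F * norm f"
        for S :: "('y, 'e) linf \<Rightarrow>\<^sub>L ('y, 'e) linf"
        using ev_op_bound[of "proj {x} o\<^sub>L S o\<^sub>L Q F" f x] by (simp add: ev_proj)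
      ultimately show "norm (ev (T f) x - ev (T' f) x) \<le> (?N T F + ?N T' F) * norm f"
        by (simp only: distrib_right) (meson add_mono norm_triangle_ineq4 order_trans)
    qed
    then have "norm (ev (T f) x - ev (T' f) x) \<le> (0 + 0) * norm f"
      by (rule tendsto_lowerbound[OF lim]) simp
    then show ?thesis by simp
  qed
qed

text \<open>The truncations of \<open>m\<close> to propagation \<open>n\<close> are band operators
  of norm at most \<open>K\<close>, being pieces of the rows. The uniform tail bound makes them
  Cauchy in norm; their limit inherits the norm bound, and its entries are those of \<open>m\<close>
  because each entry is eventually untouched by truncation.\<close>

lemma (in banach_over) operator_with_matrix_exists:
  fixes m :: "'y \<Rightarrow> 'y \<Rightarrow> ('e \<Rightarrow>\<^sub>L 'e)"
  assumes "0 \<le> K"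
    and lin: "\<And>x y. x \<in> Y \<Longrightarrow> y \<in> Y \<Longrightarrow> scalar_linear smul (m x y)"
    and fin: "\<And>x R. x \<in> Y \<Longrightarrow> finite {y \<in> Y. d x y \<le> R}"
    and bound: "\<And>x. x \<in> Y \<Longrightarrow> row_bound (m x) Y K"
    and tail: "\<And>\<epsilon>. 0 < \<epsilon> \<Longrightarrow> \<exists>R. \<forall>x\<in>Y. row_bound (m x) {y \<in> Y. R < d x y} \<epsilon>"
  obtains T where "T \<in> S_inf smul Y" "T \<in> A_inf smul Y d"
    "\<And>x y. x \<in> Y \<Longrightarrow> y \<in> Y \<Longrightarrow> mat_coeff T x y = m x y" "norm T \<le> K"
proof -
  \<comment> \<open>Rows outside \<open>Y\<close> are empty, which keeps the truncations in the
    corner determined by \<open>Y\<close>.\<close>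
  define B where "B n x = (if x \<in> Y then {y \<in> Y. d x y \<le> real n} else {})" for n :: nat and x
  have finB: "finite (B n x)" for n x
    using fin by (simp add: B_def)
  have BY: "B n x \<subseteq> Y" for n x
    by (auto simp: B_def)
  have "\<exists>T. (\<forall>f x. ev (blinfun_apply T f) x = (\<Sum>y\<in>B n x. m x y (ev f y))) \<and> norm T \<le> K" for n
  proof -
    have "row_bound (m x) (B n x) K" for x
    proof (cases "x \<in> Y")
      case True
      then show ?thesis
        using bound[OF True] BY[of n x] by (auto simp: row_bound_def)
    qed (use assms(1) in \<open>auto simp: row_bound_def B_def\<close>)
    from matrix_operator_exists[of K "B n" m, OF assms(1) finB this] show ?thesis by metis
  qed
  then obtain T where ev_T: "\<And>n f x. ev (blinfun_apply (T n) f) x = (\<Sum>y\<in>B n x. m x y (ev f y))"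
    and norm_T: "\<And>n. norm (T n) \<le> K"
    by metis
  have T_on: "T n \<in> operators_on smul Y" for n
    unfolding operators_on_def
  proof (intro CollectI conjI allI impI)
    show "T n = proj Y o\<^sub>L T n o\<^sub>L proj Y"
      using BY by (intro op_eqI) (auto simp: ev_proj ev_T B_def intro!: sum.cong)
  next
    fix c x and f g :: "('y, 'e) linf"
    assume "\<forall>y. ev g y = smul c (ev f y)"
    then show "ev (T n g) x = smul c (ev (T n f) x)"
      using lin by (auto simp: ev_T B_def scale_sum_right scalar_linear_def intro!: sum.cong)
  qed
  have T_band: "T n \<in> band_operators smul Y d" for n
    unfolding band_operators_def
  proof (intro CollectI conjI exI allI ballI T_on)
    \<comment> \<open>Cutting \<open>m\<close> to zero off \<open>B n x\<close> bounds the
      propagation by \<open>n\<close>.\<close>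
    define a where "a x y = (if y \<in> B n x then m x y else 0)" for x y
    show "band_matrix smul Y d a"
      unfolding band_matrix_def
    proof (intro conjI ballI exI[of _ K])
      fix x y assume xy: "x \<in> Y" "y \<in> Y"
      show "scalar_linear smul (a x y)"
        using lin[OF xy] by (simp add: a_def scalar_linear_def)
      show "norm (a x y) \<le> K"
        using row_bound_entry[OF bound[OF xy(1)] xy(2) assms(1)] assms(1) by (simp add: a_def)
    next
      show "bdd_above {d x y |x y. x \<in> Y \<and> y \<in> Y \<and> a x y \<noteq> 0}"
        by (rule bdd_aboveI[of _ "real n"]) (auto simp: a_def B_def split: if_splits)
    qed
    fix f x assume "x \<in> Y"
    show "ev (T n f) x = (\<Sum>y\<in>{y \<in> Y. a x y \<noteq> 0}. a x y (ev f y))"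
      \<comment> \<open>The two index sets differ only in columns of \<open>B n x\<close> where
        \<open>m x y\<close> vanishes.\<close>
      unfolding ev_T using finB BY[of n x]
      by (intro sum.mono_neutral_cong_right) (auto simp: a_def split: if_splits)
  qed
  \<comment> \<open>Row \<open>x\<close> of the difference lives on \<open>B k x - B l x\<close>,
    where \<open>d x y\<close> exceeds \<open>l\<close> and hence \<open>R\<close>, so the tail
    bound applies with \<open>c = norm f\<close>.\<close>
  have tail_le: "norm (T k - T l) \<le> \<epsilon>"
    if \<epsilon>: "0 < \<epsilon>" and R: "\<forall>x\<in>Y. row_bound (m x) {y \<in> Y. R < d x y} \<epsilon>"
      and le: "R \<le> real l" "l \<le> k" for \<epsilon> R k l
  proof (rule norm_op_le)
    fix f x
    have sub: "B l x \<subseteq> B k x"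
      using le by (auto simp: B_def)
    have "norm (\<Sum>y\<in>B k x - B l x. m x y (ev f y)) \<le> \<epsilon> * norm f"
    proof (cases "x \<in> Y")
      case True
      then show ?thesis
        using le finB[of k x]
        by (intro row_boundD[OF R[rule_format, OF True]]) (auto simp: B_def intro: ev_bound)
    qed (use \<epsilon> in \<open>simp add: B_def\<close>)
    then show "norm (ev ((T k - T l) f) x) \<le> \<epsilon> * norm f"
      using sum_diff[OF finB sub, of "\<lambda>y. m x y (ev f y)"]
      by (simp add: blinfun.diff_left ev_diff ev_T)
  qed (use \<epsilon> in simp)
  have "Cauchy T"
  proof (rule CauchyI)
    fix \<epsilon> :: real assume \<epsilon>: "0 < \<epsilon>"
    \<comment> \<open>\<open>tail_le\<close> gives only a non-strict bound; halving \<epsilon> makes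
      it strict.\<close>
    then obtain R where R: "\<forall>x\<in>Y. row_bound (m x) {y \<in> Y. R < d x y} (\<epsilon> / 2)"
      using tail[of "\<epsilon> / 2"] by auto
    obtain N where N: "R \<le> real N"
      using real_arch_simple by blast
    have "norm (T k - T l) < \<epsilon>" if "N \<le> k" "N \<le> l" for k l
    proof -
      have "norm (T k - T l) \<le> \<epsilon> / 2"
      proof (cases "l \<le> k")
        case True
        then show ?thesis
          using N that \<epsilon> by (intro tail_le[OF _ R]) auto
      next
        case False
        then show ?thesis
          unfolding norm_minus_commute[of "T k"] using N that \<epsilon> by (intro tail_le[OF _ R]) auto
      qed
      then show ?thesis using \<epsilon> by simp
    qed
    then show "\<exists>M. \<forall>m\<ge>M. \<forall>n\<ge>M. norm (T m - T n) < \<epsilon>"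
      by blast
  qed
  then obtain L where L: "T \<longlonglongrightarrow> L"
    using Cauchy_convergent[of T] unfolding convergent_def by blast
  have L_on: "L \<in> operators_on smul Y"
    by (rule operators_on_limit[OF _ L T_on]) simp
  have "L \<in> S_inf smul Y"
    unfolding S_inf_def
  proof (intro CollectI conjI allI impI L_on tendstoI)
    fix F' and \<epsilon> :: real
    assume F': "finite F' \<and> F' \<subseteq> Y" and \<epsilon>: "0 < \<epsilon>"
    obtain n where n: "norm (L - T n) < \<epsilon>"
      using LIMSEQ_D[OF L \<epsilon>] by (auto simp: norm_minus_commute)
    \<comment> \<open>\<open>G\<close> contains every column met by the rows of \<open>T n\<close>
      in \<open>F'\<close>. On those rows \<open>T n\<close> kills functions vanishing on
      \<open>G\<close>, so there \<open>L\<close> agrees with the small operator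
      \<open>L - T n\<close>.\<close>
    define G where "G = (\<Union>x\<in>F'. B n x)"
    have G: "finite G" "G \<subseteq> Y"
      unfolding G_def using F' finB by simp (intro UN_least BY)
    show "\<forall>\<^sub>F F in finite_subsets_at_top Y. dist (norm (proj F' o\<^sub>L L o\<^sub>L (proj Y - proj F))) 0 < \<epsilon>"
      unfolding eventually_finite_subsets_at_top
    proof (intro exI[of _ G] conjI allI impI G)
      fix F assume F: "finite F \<and> G \<subseteq> F \<and> F \<subseteq> Y"
      have "norm (proj F' o\<^sub>L L o\<^sub>L (proj Y - proj F)) \<le> norm (L - T n)"
      proof (rule norm_op_le)
        fix f :: "('y, 'e) linf" and x
        define g where "g = blinfun_apply (proj Y - proj F) f"
        have ev_g: "ev g y = (if y \<in> Y - F then ev f y else 0)" for y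
          using F by (auto simp: g_def blinfun.diff_left ev_diff ev_proj)
        have "norm g \<le> norm f"
          by (intro norm_linf_le) (simp add: ev_g ev_bound)
        then have *: "norm (L - T n) * norm g \<le> norm (L - T n) * norm f"
          by (simp add: mult_left_mono)
        have "ev (T n g) x = 0" if "x \<in> F'"
          using that F by (auto simp: ev_T ev_g G_def intro!: sum.neutral)
        then have "ev (L g) x = ev ((L - T n) g) x" if "x \<in> F'"
          using that by (simp add: blinfun.diff_left ev_diff)
        then show "norm (ev ((proj F' o\<^sub>L L o\<^sub>L (proj Y - proj F)) f) x) \<le> norm (L - T n) * norm f"
          using order_trans[OF ev_op_bound *, of x] by (simp add: ev_proj flip: g_def)
      qed simp
      then show "dist (norm (proj F' o\<^sub>L L o\<^sub>L (proj Y - proj F))) 0 < \<epsilon>"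
        using n by simp
    qed
  qed
  moreover have "L \<in> A_inf smul Y d"
    unfolding A_inf_def closure_sequential using T_band L by blast
  moreover have "mat_coeff L x y = m x y" if "x \<in> Y" "y \<in> Y" for x y
  proof (rule blinfun_eqI)
    fix e
    \<comment> \<open>From \<open>N\<close> on, column \<open>y\<close> belongs to the truncated row
      \<open>x\<close>, so the coefficient is constant in \<open>n\<close>.\<close>
    obtain N where N: "d x y \<le> real N"
      using real_arch_simple by blast
    have "(\<lambda>n. ev (T n (delta y e)) x) \<longlonglongrightarrow> ev (L (delta y e)) x"
      by (rule tendsto_op_ev[OF L])
    moreover have "\<forall>\<^sub>F n in sequentially. ev (T n (delta y e)) x = m x y e"
      using eventually_ge_at_top[of N]
    proof eventually_elim
      fix n assume "N \<le> n"
      then have "y \<in> B n x"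
        using N that by (simp add: B_def)
      moreover have "m x z (if z = y then e else 0) = (if z = y then m x y e else 0)" for z
        by simp
      ultimately show "ev (T n (delta y e)) x = m x y e"
        using finB by (simp add: ev_T ev_delta)
    qed
    ultimately have "(\<lambda>n. m x y e) \<longlonglongrightarrow> ev (L (delta y e)) x"
      by (rule Lim_transform_eventually)
    then show "mat_coeff L x y e = m x y e"
      by (simp add: mat_coeff_apply LIMSEQ_const_iff)
  qed
  moreover have "norm L \<le> K"
    by (rule tendsto_upperbound[OF tendsto_norm[OF L]]) (simp_all add: norm_T)
  ultimately show thesis
    by (rule that)
qed

text \<open>Take a band operator \<open>B\<close> within \<epsilon> of \<open>A\<close> and let
  \<open>R\<close> bound its propagation. Beyond distance \<open>R\<close> the coefficients of
  \<open>A\<close> are those of \<open>A - B\<close>, and every piece of a row of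
  \<open>A - B\<close> is bounded by its norm. The same \<open>R\<close> serves all rows.\<close>

lemma A_inf_tail:
  fixes A :: "('x::metric_space, 'e::real_normed_vector) linf \<Rightarrow>\<^sub>L ('x, 'e) linf"
  assumes A: "A \<in> A_inf smul UNIV dist" and "0 < \<epsilon>"
  shows "\<exists>R. \<forall>x. row_bound (mat_coeff A x) {y. R < dist x y} \<epsilon>"
proof -
  obtain B where B: "B \<in> band_operators smul UNIV dist" and AB: "norm (A - B) < \<epsilon>"
    using assms unfolding A_inf_def closure_approachable by (auto simp: dist_norm norm_minus_commute)
  obtain a :: "'x \<Rightarrow> 'x \<Rightarrow> ('e \<Rightarrow>\<^sub>L 'e)" where "bdd_above {dist x y |x y. a x y \<noteq> 0}"
    and ev_B: "\<And>f x. ev (B f) x = (\<Sum>y\<in>{y. a x y \<noteq> 0}. a x y (ev f y))"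
    using B unfolding band_operators_def band_matrix_def by auto
  then obtain R where R: "\<And>x y. a x y \<noteq> 0 \<Longrightarrow> dist x y \<le> R"
    unfolding bdd_above_def by blast
  have "mat_coeff B x y = 0" if "R < dist x y" for x y
  proof (rule blinfun_eqI)
    fix e
    \<comment> \<open>For \<open>z\<close> different from \<open>y\<close> the argument is 0; for
      \<open>z = y\<close> the entry \<open>a x y\<close> vanishes beyond \<open>R\<close>.\<close>
    have "a x z (ev (delta y e) z) = 0" for z
      using R[of x y] that by (cases "z = y"; cases "a x y = 0") (auto simp: ev_delta)
    then show "mat_coeff B x y e = blinfun_apply 0 e"
      by (simp add: mat_coeff_apply ev_B)
  qed
  then have eq: "mat_coeff A x y = mat_coeff (A - B) x y" if "R < dist x y" for x y
    using that by (simp add: mat_coeff_diff)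
  have "row_bound (mat_coeff A x) {y. R < dist x y} \<epsilon>" for x
  proof (rule row_boundI)
    fix F and g :: "'x \<Rightarrow> 'e" and c :: real
    assume F: "finite F" "F \<subseteq> {y. R < dist x y}" "0 \<le> c" "\<And>y. y \<in> F \<Longrightarrow> norm (g y) \<le> c"
    have "(\<Sum>y\<in>F. mat_coeff A x y (g y)) = (\<Sum>y\<in>F. mat_coeff (A - B) x y (g y))"
      using F(2) eq by (intro sum.cong) auto
    also have "norm \<dots> \<le> norm (A - B) * c"
      using F by (intro row_boundD[OF row_bound_mat_coeff[where S = UNIV]]) auto
    also have "\<dots> \<le> \<epsilon> * c"
      using AB F(3) by (intro mult_right_mono) auto
    finally show "norm (\<Sum>y\<in>F. mat_coeff A x y (g y)) \<le> \<epsilon> * c" .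
  qed
  then show ?thesis by blast
qed

section \<open>Ultrafilter limits\<close>

lemma ultrafilter_disj:
  assumes "ultrafilter \<omega>"
  shows "(\<forall>\<^sub>F x in \<omega>. P x) \<or> (\<forall>\<^sub>F x in \<omega>. \<not> P x)"
proof -
  have "(\<forall>\<^sub>F x in \<omega>. x \<in> {x. P x}) \<or> (\<forall>\<^sub>F x in \<omega>. x \<notin> {x. P x})"
    using assms unfolding ultrafilter_def by blast
  then show ?thesis by simp
qed

text \<open>Compactness gives a cluster point of the image filter. For an ultrafilter it is a limit:
  if the preimage of a neighbourhood were not large, its complement would be, contradicting
  clustering.\<close>

lemma ultrafilter_tendsto_compact:
  assumes "ultrafilter \<omega>" "compact K" "\<forall>\<^sub>F x in \<omega>. f x \<in> K"
  shows "\<exists>l. (f \<longlongrightarrow> l) \<omega>"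
proof -
  have "filtermap f \<omega> \<noteq> bot"
    using assms(1) by (simp add: ultrafilter_def filtermap_bot_iff)
  moreover have "\<forall>\<^sub>F z in filtermap f \<omega>. z \<in> K"
    using assms(3) by (simp add: eventually_filtermap)
  ultimately obtain l where l: "inf (nhds l) (filtermap f \<omega>) \<noteq> bot"
    using assms(2) unfolding compact_filter by blast
  have "(f \<longlongrightarrow> l) \<omega>"
  proof (rule topological_tendstoI, rule ccontr)
    fix S assume S: "open S" "l \<in> S" and "\<not> (\<forall>\<^sub>F x in \<omega>. f x \<in> S)"
    then have "\<forall>\<^sub>F z in filtermap f \<omega>. z \<notin> S"
      using ultrafilter_disj[OF assms(1), of "\<lambda>x. f x \<in> S"] by (simp add: eventually_filtermap)
    moreover have "\<forall>\<^sub>F z in nhds l. z \<in> S"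
      using S by (rule eventually_nhds_in_open)
    ultimately have "\<forall>\<^sub>F z in inf (nhds l) (filtermap f \<omega>). False"
      unfolding eventually_inf by blast
    then show False
      using l by (simp add: trivial_limit_def)
  qed
  then show ?thesis ..
qed

section \<open>Distances, matrix entries and balls in the limit space\<close>

lemma compatible_dist_bound:
  assumes "compatible \<omega> t"
  obtains C where "\<forall>\<^sub>F x in \<omega>. dist x (app t x) \<le> C"
proof -
  obtain C where "\<And>x. x \<in> dom t \<Longrightarrow> dist x (app t x) \<le> C"
    using assms unfolding compatible_def partial_translation_def bdd_above_def by auto
  then have "\<forall>\<^sub>F x in \<omega>. dist x (app t x) \<le> C"
    using assms unfolding compatible_def by (blast intro: eventually_mono)
  then show thesis
    by (rule that)
qed

text \<open>\<open>Lim\<close> is informative only once a limit is known to exist. Both translations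
  displace points boundedly, so the distances eventually lie in a compact interval, and the
  ultrafilter converges there.\<close>

lemma limit_dist_tendsto:
  assumes "ultrafilter \<omega>" "compatible \<omega> (t \<alpha>)" "compatible \<omega> (t \<beta>)"
  shows "((\<lambda>x. dist (app (t \<alpha>) x) (app (t \<beta>) x)) \<longlongrightarrow> limit_dist \<omega> t \<alpha> \<beta>) \<omega>"
proof -
  obtain C D where "\<forall>\<^sub>F x in \<omega>. dist x (app (t \<alpha>) x) \<le> C" "\<forall>\<^sub>F x in \<omega>. dist x (app (t \<beta>) x) \<le> D"
    using compatible_dist_bound assms(2,3) by metis
  then have "\<forall>\<^sub>F x in \<omega>. dist (app (t \<alpha>) x) (app (t \<beta>) x) \<in> {0..C + D}"
  proof eventually_elim
    case (elim x)
    then show ?case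
      using dist_triangle3[of "app (t \<alpha>) x" "app (t \<beta>) x" x] by simp
  qed
  from ultrafilter_tendsto_compact[OF assms(1) compact_Icc this]
  obtain l where "((\<lambda>x. dist (app (t \<alpha>) x) (app (t \<beta>) x)) \<longlongrightarrow> l) \<omega>" ..
  moreover have "\<omega> \<noteq> bot"
    using assms(1) by (simp add: ultrafilter_def)
  ultimately show ?thesis
    unfolding limit_dist_def by (metis tendsto_Lim)
qed

lemma limit_matrix_tendsto:
  assumes "\<omega> \<noteq> bot" "rich_at \<omega> A" "compatible \<omega> (t \<alpha>)" "compatible \<omega> (t \<beta>)"
  shows "((\<lambda>x. mat_coeff A (app (t \<alpha>) x) (app (t \<beta>) x)) \<longlongrightarrow> limit_matrix \<omega> t A \<alpha> \<beta>) \<omega>"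
proof -
  obtain L where "((\<lambda>x. mat_coeff A (app (t \<alpha>) x) (app (t \<beta>) x)) \<longlongrightarrow> L) \<omega>"
    using assms(2-) unfolding rich_at_def by blast
  moreover from this have "limit_matrix \<omega> t A \<alpha> \<beta> = L"
    unfolding limit_matrix_def by (rule tendsto_Lim[OF assms(1)])
  ultimately show ?thesis by simp
qed

text \<open>The ultrafilter decides between agreement and disagreement, and maps that agree almost
  everywhere have the same image filter.\<close>

lemma app_eventually_neq:
  assumes "ultrafilter \<omega>" "translate s \<omega> \<noteq> translate t \<omega>"
  shows "\<forall>\<^sub>F x in \<omega>. app s x \<noteq> app t x"
proof (rule ccontr)
  assume "\<not> ?thesis"
  then have "\<forall>\<^sub>F x in \<omega>. app s x = app t x"
    using ultrafilter_disj[OF assms(1), of "\<lambda>x. app s x \<noteq> app t x"] by simp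
  then have "\<forall>\<^sub>F x in \<omega>. P (app s x) \<longleftrightarrow> P (app t x)" for P
    by (rule eventually_mono) simp
  then have "translate s \<omega> = translate t \<omega>"
    unfolding translate_def filter_eq_iff eventually_filtermap by (intro allI eventually_subst)
  then show False
    using assms(2) by simp
qed

text \<open>Finitely many points of the limit ball are represented, at \<omega>-almost every
  \<open>x\<close>, by distinct points \<open>app (t \<beta>) x\<close> of one ball of the original
  space, whose cardinality is uniformly bounded.\<close>

lemma finite_limit_ball:
  assumes uf: "ultrafilter \<omega>" and t: "compatible_family \<omega> t" and \<alpha>: "\<alpha> \<in> limit_space \<omega>"
    and bg: "bounded_geometry TYPE('x::metric_space)"
  shows "finite {\<beta> \<in> limit_space (\<omega> :: 'x filter). limit_dist \<omega> t \<alpha> \<beta> \<le> R}"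
proof -
  \<comment> \<open>A limit distance at most \<open>R\<close> forces the approximating distances
    only below \<open>R + 1\<close>, hence the larger radius.\<close>
  obtain N where N: "\<And>x::'x. finite (cball x (R + 1)) \<and> card (cball x (R + 1)) \<le> N"
    using bg unfolding bounded_geometry_def by metis
  have nb: "\<omega> \<noteq> bot"
    using uf by (simp add: ultrafilter_def)
  have comp: "compatible \<omega> (t \<beta>)" "translate (t \<beta>) \<omega> = \<beta>" if "\<beta> \<in> limit_space \<omega>" for \<beta>
    using t that by (auto simp: compatible_family_def)
  show ?thesis
  proof (rule ccontr)
    assume "infinite {\<beta> \<in> limit_space \<omega>. limit_dist \<omega> t \<alpha> \<beta> \<le> R}"
    then obtain F where F: "finite F" "card F = Suc N"
      and sub: "F \<subseteq> {\<beta> \<in> limit_space \<omega>. limit_dist \<omega> t \<alpha> \<beta> \<le> R}"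
      using infinite_arbitrarily_large by blast
    have "\<forall>\<^sub>F x in \<omega>. \<forall>\<beta>\<in>F. \<forall>\<gamma>\<in>F. \<beta> \<noteq> \<gamma> \<longrightarrow> app (t \<beta>) x \<noteq> app (t \<gamma>) x"
    proof (intro eventually_ball_finite F ballI)
      fix \<beta> \<gamma> assume "\<beta> \<in> F" "\<gamma> \<in> F"
      then have "\<beta> \<in> limit_space \<omega>" "\<gamma> \<in> limit_space \<omega>"
        using sub by auto
      then show "\<forall>\<^sub>F x in \<omega>. \<beta> \<noteq> \<gamma> \<longrightarrow> app (t \<beta>) x \<noteq> app (t \<gamma>) x"
        using app_eventually_neq[OF uf, of "t \<beta>" "t \<gamma>"] comp(2)
        by (cases "\<beta> = \<gamma>") auto
    qed
    moreover have "\<forall>\<^sub>F x in \<omega>. \<forall>\<beta>\<in>F. dist (app (t \<alpha>) x) (app (t \<beta>) x) < R + 1"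
    proof (intro eventually_ball_finite F ballI)
      fix \<beta> assume "\<beta> \<in> F"
      then show "\<forall>\<^sub>F x in \<omega>. dist (app (t \<alpha>) x) (app (t \<beta>) x) < R + 1"
        using sub comp(1) \<alpha> by (intro order_tendstoD(2)[OF limit_dist_tendsto[OF uf]]) fastforce+
    qed
    ultimately have "\<forall>\<^sub>F x in \<omega>. False"
    proof eventually_elim
      case (elim x)
      have "inj_on (\<lambda>\<beta>. app (t \<beta>) x) F"
        using elim(1) by (auto simp: inj_on_def)
      then have "card F = card ((\<lambda>\<beta>. app (t \<beta>) x) ` F)"
        by (simp add: card_image)
      also have "\<dots> \<le> card (cball (app (t \<alpha>) x) (R + 1))"
        using elim(2) N by (intro card_mono) (auto intro: less_imp_le)
      also have "\<dots> \<le> N"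
        using N by blast
      finally show ?case
        using F(2) by simp
    qed
    then show False
      using nb by (simp add: trivial_limit_def)
  qed
qed

theorem proposition3p15:
  fixes smul :: "'k::real_normed_field \<Rightarrow> 'e::banach \<Rightarrow> 'e"
    and \<omega> :: "'x::metric_space filter"
    and t :: "'x filter \<Rightarrow> 'x \<rightharpoonup> 'x"
    and A :: "('x, 'e) linf \<Rightarrow>\<^sub>L ('x, 'e) linf"
  assumes "banach_over smul"
    and "strongly_discrete TYPE('x)" and "bounded_geometry TYPE('x)"
    and "nonprincipal_ultrafilter \<omega>"
    and "A \<in> A_inf smul UNIV dist"
    and "rich_at \<omega> A"
    and "compatible_family \<omega> t"
  shows "(\<exists>!T. T \<in> S_inf smul (limit_space \<omega>) \<and>
             (\<forall>\<alpha>\<in>limit_space \<omega>. \<forall>\<beta>\<in>limit_space \<omega>. mat_coeff T \<alpha> \<beta> = limit_matrix \<omega> t A \<alpha> \<beta>) \<and>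
             norm T \<le> norm A) \<and>
         (\<forall>T. T \<in> S_inf smul (limit_space \<omega>) \<and>
             (\<forall>\<alpha>\<in>limit_space \<omega>. \<forall>\<beta>\<in>limit_space \<omega>. mat_coeff T \<alpha> \<beta> = limit_matrix \<omega> t A \<alpha> \<beta>) \<and>
             norm T \<le> norm A \<longrightarrow>
             T \<in> A_inf smul (limit_space \<omega>) (limit_dist \<omega> t))"
proof -
  interpret banach_over smul by fact
  define Y where "Y = limit_space \<omega>"
  define m where "m = limit_matrix \<omega> t A"
  have uf: "ultrafilter \<omega>"
    using assms(4) by (simp add: nonprincipal_ultrafilter_def)
  then have nb: "\<omega> \<noteq> bot"
    by (simp add: ultrafilter_def)
  have comp: "compatible \<omega> (t \<alpha>)" "translate (t \<alpha>) \<omega> = \<alpha>" if "\<alpha> \<in> Y" for \<alpha>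
    using assms(7) that by (auto simp: compatible_family_def Y_def)
  have lim: "((\<lambda>x. mat_coeff A (app (t \<alpha>) x) (app (t \<beta>) x)) \<longlongrightarrow> m \<alpha> \<beta>) \<omega>"
    if "\<alpha> \<in> Y" "\<beta> \<in> Y" for \<alpha> \<beta>
    unfolding m_def using nb assms(6) comp that by (intro limit_matrix_tendsto)
  have sep: "\<forall>\<^sub>F x in \<omega>. app (t \<beta>) x \<noteq> app (t \<gamma>) x" if "\<beta> \<in> Y" "\<gamma> \<in> Y" "\<beta> \<noteq> \<gamma>" for \<beta> \<gamma>
    using app_eventually_neq[OF uf, of "t \<beta>" "t \<gamma>"] comp that by simp
  have "0 \<le> norm A" by simp
  \<comment> \<open>The entries of \<open>A\<close> are linear over \<open>'k\<close>, and so are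
    their norm limits.\<close>
  moreover have "scalar_linear smul (m \<alpha> \<beta>)" if "\<alpha> \<in> Y" "\<beta> \<in> Y" for \<alpha> \<beta>
    using subsetD[OF A_inf_subset_operators_on assms(5)]
    by (intro scalar_linear_limit[OF nb lim[OF that]] always_eventually allI scalar_linear_mat_coeff)
  moreover have "finite {\<beta> \<in> Y. limit_dist \<omega> t \<alpha> \<beta> \<le> R}" if "\<alpha> \<in> Y" for \<alpha> R
    using finite_limit_ball[OF uf assms(7) _ assms(3)] that by (simp add: Y_def)
  \<comment> \<open>Row \<alpha> is the limit of the rows of \<open>A\<close> at
    \<open>app (t \<alpha>) x\<close>, read in the columns \<open>app (t \<beta>) x\<close>; each
    such row is bounded by \<open>norm A\<close>.\<close>
  moreover have "row_bound (m \<alpha>) Y (norm A)" if "\<alpha> \<in> Y" for \<alpha>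
    by (rule row_bound_limit[OF nb, where r = "\<lambda>x. mat_coeff A (app (t \<alpha>) x)" and S = "\<lambda>_. UNIV"
          and \<tau> = "\<lambda>\<beta>. app (t \<beta>)"]) (use that lim sep row_bound_mat_coeff in auto)
  moreover have "\<exists>R. \<forall>\<alpha>\<in>Y. row_bound (m \<alpha>) {\<beta> \<in> Y. R < limit_dist \<omega> t \<alpha> \<beta>} \<epsilon>" if \<epsilon>: "0 < \<epsilon>" for \<epsilon>
  proof -
    obtain R where R: "\<And>x. row_bound (mat_coeff A x) {y. R < dist x y} \<epsilon>"
      using A_inf_tail[OF assms(5) \<epsilon>] by blast
    have "row_bound (m \<alpha>) {\<beta> \<in> Y. R < limit_dist \<omega> t \<alpha> \<beta>} \<epsilon>" if \<alpha>: "\<alpha> \<in> Y" for \<alpha>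
    proof (rule row_bound_limit[OF nb, where r = "\<lambda>x. mat_coeff A (app (t \<alpha>) x)"
          and S = "\<lambda>x. {y. R < dist (app (t \<alpha>) x) y}" and \<tau> = "\<lambda>\<beta>. app (t \<beta>)"])
      \<comment> \<open>A limit distance strictly above \<open>R\<close> is strictly above
        \<open>R\<close> already at almost every \<open>x\<close>, so these columns lie in the tail
        of the row of \<open>A\<close>.\<close>
      fix \<beta> assume "\<beta> \<in> {\<beta> \<in> Y. R < limit_dist \<omega> t \<alpha> \<beta>}"
      then show "\<forall>\<^sub>F x in \<omega>. app (t \<beta>) x \<in> {y. R < dist (app (t \<alpha>) x) y}"
        using order_tendstoD(1)[OF limit_dist_tendsto[OF uf, of t \<alpha> \<beta>]] comp \<alpha> by simp
    qed (use R \<alpha> lim sep in auto)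
    then show ?thesis by blast
  qed
  ultimately obtain T where T: "T \<in> S_inf smul Y" "T \<in> A_inf smul Y (limit_dist \<omega> t)"
    "\<And>\<alpha> \<beta>. \<alpha> \<in> Y \<Longrightarrow> \<beta> \<in> Y \<Longrightarrow> mat_coeff T \<alpha> \<beta> = m \<alpha> \<beta>" "norm T \<le> norm A"
    by (rule operator_with_matrix_exists) (assumption | rule that)+
  \<comment> \<open>This gives uniqueness, and also the last claim: any operator as described is
    \<open>T\<close>, which lies in \<open>A_inf\<close>.\<close>
  have "T' = T" if "T' \<in> S_inf smul Y" "\<forall>\<alpha>\<in>Y. \<forall>\<beta>\<in>Y. mat_coeff T' \<alpha> \<beta> = m \<alpha> \<beta>" for T'
    using that T by (intro S_inf_eqI[of T' smul Y T]) auto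
  then show ?thesis
    using T unfolding Y_def m_def by blast
qed

end
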